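(* Let $\Gamma$ denote the map $\Gamma:\mathbb{R}^{m\times n\times s}\to\mathbb{R}^{sm\times sn}$, $\Gamma(A):=\mathrm{bcirc}(A)$ (defined for all positive integers $m,n,s$). Then $\Gamma$ is a linear map. Moreover, for all $A\in\mathbb{R}^{m\times n\times s}$ and $B\in\mathbb{R}^{n\times p\times s}$, $$\Gamma(A\star B)=\Gamma(A)\Gamma(B).$$
   Context: A cubic matrix $A=(a_{i,j,k})\in\mathbb{R}^{m\times n\times s}$ has frontal slices $A^{(k)}=(a_{i,j,k})_{i,j}\in\mathbb{R}^{m\times n}$, $k\in[1,s]$, and is identified with the $sm\times n$ block-column matrix with blocks $A^{(1)},\dots,A^{(s)}$. Addition and scalar multiplication are entrywise. The block circulant matrix is $$\mathrm{bcirc}(A)=\begin{bmatrix} A^{(1)} & A^{(s)} & A^{(s-1)} & \cdots & A^{(2)} \\ A^{(2)} & A^{(1)} & A^{(s)} & \cdots & A^{(3)} \\ \vdots & & & \ddots & \vdots \\ A^{(s)} & A^{(s-1)} & A^{(s-2)} & \cdots & A^{(1)} \end{bmatrix}\in\mathbb{R}^{sm\times sn}.$$ For $A\in\mathbb{R}^{m\times n\times s}$, $B\in\mathbb{R}^{n\times p\times s}$ the t-product is $A\star B:=\mathrm{bcirc}(A)\,B$ (ordinary matrix product with the $sn\times p$ block column of $B$), identified with an element of $\mathbb{R}^{m\times p\times s}$. *)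

theory Defs
  imports "Jordan_Normal_Form.VS_Connect"
begin

text \<open>All indices start at 0 (as for the type \<open>mat\<close>), so the entry \<open>a\<^sub>i\<^sub>j\<^sub>k\<close> of the paper-and-pencil
  notation, with indices starting at 1, is \<open>A (i - 1, j - 1, k - 1)\<close>, and the slice written
  \<open>A\<^sup>(\<^sup>k\<^sup>)\<close> there is \<open>frontal_slice m n A (k - 1)\<close>.\<close>

definition cubic_index :: "nat \<Rightarrow> nat \<Rightarrow> nat \<Rightarrow> (nat \<times> nat \<times> nat) set" where
  "cubic_index m n s = {..<m} \<times> {..<n} \<times> {..<s}"

text \<open>Extensional functions are used so that equality of functions is equality of arrays.\<close>

definition carrier_cubic :: "nat \<Rightarrow> nat \<Rightarrow> nat \<Rightarrow> (nat \<times> nat \<times> nat \<Rightarrow> real) set" where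
  "carrier_cubic m n s = (cubic_index m n s \<rightarrow>\<^sub>E UNIV)"

text \<open>The fields \<open>mult\<close> and \<open>one\<close> occur only because the record type of modules extends that of
  rings; no module axiom refers to them.\<close>

definition module_cubic ::
    "nat \<Rightarrow> nat \<Rightarrow> nat \<Rightarrow> (real, nat \<times> nat \<times> nat \<Rightarrow> real) module" where
  "module_cubic m n s =
    \<lparr> carrier = carrier_cubic m n s,
      mult = undefined,
      one = undefined,
      zero = (\<lambda>t\<in>cubic_index m n s. 0),
      add = (\<lambda>A B. \<lambda>t\<in>cubic_index m n s. A t + B t),
      smult = (\<lambda>c A. \<lambda>t\<in>cubic_index m n s. c * A t) \<rparr>"

definition frontal_slice :: "nat \<Rightarrow> nat \<Rightarrow> (nat \<times> nat \<times> nat \<Rightarrow> real) \<Rightarrow> nat \<Rightarrow> real mat" where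
  "frontal_slice m n A k = mat m n (\<lambda>(i, j). A (i, j, k))"

text \<open>The identification of cubic matrices with block columns, and its inverse.\<close>

definition block_column ::
    "nat \<Rightarrow> nat \<Rightarrow> nat \<Rightarrow> (nat \<times> nat \<times> nat \<Rightarrow> real) \<Rightarrow> real mat" where
  "block_column m n s A =
    mat (s * m) n (\<lambda>(i, j). frontal_slice m n A (i div m) $$ (i mod m, j))"

definition cubic_of_block_column ::
    "nat \<Rightarrow> nat \<Rightarrow> nat \<Rightarrow> real mat \<Rightarrow> nat \<times> nat \<times> nat \<Rightarrow> real" where
  "cubic_of_block_column m n s M = (\<lambda>(i, j, k)\<in>cubic_index m n s. M $$ (k * m + i, j))"

text \<open>The block in block row \<open>p\<close> and block column \<open>q\<close> is the slice with index \<open>p - q\<close> modulo \<open>s\<close>;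
  the summand \<open>s\<close> prevents truncated subtraction, as \<open>q < s\<close>.\<close>

definition bcirc :: "nat \<Rightarrow> nat \<Rightarrow> nat \<Rightarrow> (nat \<times> nat \<times> nat \<Rightarrow> real) \<Rightarrow> real mat" where
  "bcirc m n s A =
    mat (s * m) (s * n) (\<lambda>(i, j).
      frontal_slice m n A ((s + i div m - j div n) mod s) $$ (i mod m, j mod n))"

definition t_product :: "nat \<Rightarrow> nat \<Rightarrow> nat \<Rightarrow> nat \<Rightarrow>
    (nat \<times> nat \<times> nat \<Rightarrow> real) \<Rightarrow> (nat \<times> nat \<times> nat \<Rightarrow> real) \<Rightarrow> nat \<times> nat \<times> nat \<Rightarrow> real" where
  "t_product m n p s A B =
    cubic_of_block_column m p s (bcirc m n s A * block_column n p s B)"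

lemma cubic_of_block_column_block_column:
  assumes "A \<in> carrier_cubic m n s"
  shows "cubic_of_block_column m n s (block_column m n s A) = A"
proof
  fix t :: "nat \<times> nat \<times> nat"
  obtain i j k where t: "t = (i, j, k)" by (cases t)
  show "cubic_of_block_column m n s (block_column m n s A) t = A t"
  proof (cases "t \<in> cubic_index m n s")
    case True
    then have b: "i < m" "j < n" "k < s" by (auto simp: t cubic_index_def)
    have "k * m + i < Suc k * m" using b by simp
    also have "\<dots> \<le> s * m" using b by (intro mult_le_mono1) simp
    finally have "k * m + i < s * m" .
    with b True show ?thesis
      by (simp add: t cubic_of_block_column_def block_column_def frontal_slice_def)
  next
    case False
    have "A t = undefined"
      using assms False unfolding carrier_cubic_def by (rule PiE_arb)
    with False show ?thesis unfolding cubic_of_block_column_def by (simp only: restrict_apply if_False)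
  qed
qed

lemma block_column_cubic_of_block_column:
  assumes "M \<in> carrier_mat (s * m) n"
  shows "block_column m n s (cubic_of_block_column m n s M) = M"
proof (rule eq_matI)
  fix i j assume "i < dim_row M" "j < dim_col M"
  with assms have b: "i < s * m" "j < n" by auto
  then have "0 < m" by (cases m) auto
  with b have "i mod m < m" "i div m < s"
    by (auto simp: less_mult_imp_div_less)
  with b show "block_column m n s (cubic_of_block_column m n s M) $$ (i, j) = M $$ (i, j)"
    by (simp add: block_column_def cubic_of_block_column_def frontal_slice_def cubic_index_def)
qed (use assms in \<open>auto simp: block_column_def\<close>)

end

theory Submission
  imports Defs
begin

text \<open>Both sides of the multiplicativity claim are sums over a block index and an index within the
  block. With \<open>r\<close> the difference of the outer block row and block column modulo \<open>s\<close>, the entries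
  agree after the cyclic shift of the block index by the block column, because block circulant
  entries depend only on differences modulo \<open>s\<close>.\<close>

lemma dim_bcirc:
  "dim_row (bcirc m n s A) = s * m"
  "dim_col (bcirc m n s A) = s * n"
  by (simp_all add: bcirc_def)

lemma bcirc_carrier_mat: "bcirc m n s A \<in> carrier_mat (s * m) (s * n)"
  by (simp add: bcirc_def)

lemma bcirc_index:
  assumes "i < s * m" and "j < s * n"
  shows "bcirc m n s A $$ (i, j) = A (i mod m, j mod n, (s + i div m - j div n) mod s)"
proof -
  \<comment> \<open>An index in range forces positive block dimensions, so the remainders
    \<open>i mod m\<close> and \<open>j mod n\<close> are valid positions within a slice.\<close>
  have "0 < m" and "0 < n" using assms by (auto intro: gr0I)
  then show ?thesis using assms by (simp add: bcirc_def frontal_slice_def)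
qed

lemma block_column_index:
  assumes "i < s * m" and "j < n"
  shows "block_column m n s A $$ (i, j) = A (i mod m, j, i div m)"
proof -
  have "0 < m" using assms by (auto intro: gr0I)
  then show ?thesis using assms by (simp add: block_column_def frontal_slice_def)
qed

lemma block_index_less:
  fixes k m i s :: nat
  assumes "k < s" and "i < m"
  shows "k * m + i < s * m"
proof -
  have "k * m + i < Suc k * m" using assms by simp
  also have "\<dots> \<le> s * m" using assms by (intro mult_le_mono1) simp
  finally show ?thesis .
qed

text \<open>Division with remainder matches each \<open>l < s * n\<close> with the pair of block
  index \<open>q\<close> and offset \<open>c\<close> such that \<open>l = q * n + c\<close>. For
  \<open>n = 0\<close> both sides are empty sums.\<close>

lemma sum_div_mod:
  fixes f :: "nat \<Rightarrow> nat \<Rightarrow> 'a :: comm_monoid_add"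
  shows "(\<Sum>l = 0..<s * n. f (l div n) (l mod n)) = (\<Sum>q<s. \<Sum>c<n. f q c)"
proof (cases "n = 0")
  case False
  have "(\<Sum>q<s. \<Sum>c<n. f q c) = (\<Sum>(q, c)\<in>{..<s} \<times> {..<n}. f q c)"
    by (simp add: sum.cartesian_product)
  also have "\<dots> = (\<Sum>l = 0..<s * n. f (l div n) (l mod n))"
    using False
    by (intro sum.reindex_bij_witness[where i = "\<lambda>l. (l div n, l mod n)" and j = "\<lambda>(q, c). q * n + c"])
      (auto simp: block_index_less less_mult_imp_div_less)
  finally show ?thesis ..
qed simp

text \<open>Turns the cyclic index identities below, whose arguments all stay under
  \<open>2 * s\<close>, into case distinctions in linear arithmetic.\<close>

lemma mod_less_cases:
  fixes x s :: nat
  assumes "x < 2 * s"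
  shows "x mod s = (if x < s then x else x - s)"
  using assms by (simp add: mod_if)

text \<open>Subtracting \<open>b\<close> modulo \<open>s\<close> permutes the block indices, with
  addition of \<open>b\<close> as inverse.\<close>

lemma sum_cyclic_shift:
  fixes g :: "nat \<Rightarrow> 'a :: comm_monoid_add"
  assumes "b < s"
  shows "(\<Sum>q<s. g ((s + q - b) mod s)) = (\<Sum>q<s. g q)"
  using assms
  by (intro sum.reindex_bij_witness[where i = "\<lambda>q. (q + b) mod s" and j = "\<lambda>q. (s + q - b) mod s"])
    (auto simp: mod_less_cases)

text \<open>This is (a - b) - (q - b) = a - q modulo \<open>s\<close>; each added \<open>s\<close>
  keeps natural subtraction from truncating.\<close>

lemma cyclic_difference_shift:
  fixes a b q s :: nat
  assumes "a < s" and "b < s" and "q < s"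
  shows "(s + (s + a - b) mod s - (s + q - b) mod s) mod s = (s + a - q) mod s"
  using assms by (auto simp: mod_less_cases)

lemma t_product_index:
  assumes "i < m" and "j < p" and "k < s"
  shows "t_product m n p s A B (i, j, k) =
    (\<Sum>q<s. \<Sum>c<n. A (i, c, (s + k - q) mod s) * B (c, j, q))"
proof -
  \<comment> \<open>Row \<open>k * m + i\<close> of the block column holds the entry
    \<open>(i, j, k)\<close>.\<close>
  have b: "k * m + i < s * m" using assms by (intro block_index_less)
  have "t_product m n p s A B (i, j, k) =
      (\<Sum>l = 0..<s * n. bcirc m n s A $$ (k * m + i, l) * block_column n p s B $$ (l, j))"
    using assms b
    by (simp add: t_product_def cubic_of_block_column_def cubic_index_def scalar_prod_def
        bcirc_def block_column_def)
  also have "\<dots> = (\<Sum>l = 0..<s * n. A (i, l mod n, (s + k - l div n) mod s) * B (l mod n, j, l div n))"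
    using assms b by (intro sum.cong) (auto simp: bcirc_index block_column_index)
  also have "\<dots> = (\<Sum>q<s. \<Sum>c<n. A (i, c, (s + k - q) mod s) * B (c, j, q))"
    by (rule sum_div_mod)
  finally show ?thesis .
qed

lemma bcirc_mult_index:
  assumes "i < s * m" and "j < s * p"
  shows "(bcirc m n s A * bcirc n p s B) $$ (i, j) =
    (\<Sum>q<s. \<Sum>c<n. A (i mod m, c, (s + i div m - q) mod s) *
      B (c, j mod p, (s + q - j div p) mod s))"
proof -
  have "(bcirc m n s A * bcirc n p s B) $$ (i, j) =
      (\<Sum>l = 0..<s * n. bcirc m n s A $$ (i, l) * bcirc n p s B $$ (l, j))"
    using assms by (simp add: scalar_prod_def bcirc_def)
  also have "\<dots> = (\<Sum>l = 0..<s * n. A (i mod m, l mod n, (s + i div m - l div n) mod s) *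
      B (l mod n, j mod p, (s + l div n - j div p) mod s))"
    using assms by (intro sum.cong) (auto simp: bcirc_index)
  also have "\<dots> = (\<Sum>q<s. \<Sum>c<n. A (i mod m, c, (s + i div m - q) mod s) *
      B (c, j mod p, (s + q - j div p) mod s))"
    by (rule sum_div_mod)
  finally show ?thesis .
qed

lemma bcirc_t_product:
  "bcirc m p s (t_product m n p s A B) = bcirc m n s A * bcirc n p s B"
proof (rule eq_matI)
  fix i j
  assume "i < dim_row (bcirc m n s A * bcirc n p s B)"
    and "j < dim_col (bcirc m n s A * bcirc n p s B)"
  then have ij: "i < s * m" "j < s * p" by (auto simp: bcirc_def)
  then have b: "i mod m < m" "j mod p < p" "i div m < s" "j div p < s"
    by (auto simp: less_mult_imp_div_less intro!: mod_less_divisor gr0I)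
  \<comment> \<open>The slice of the t-product that supplies entry \<open>(i, j)\<close> of its
    block circulant matrix.\<close>
  define r where "r = (s + i div m - j div p) mod s"
  have "r < s" using b by (simp add: r_def)
  define g where
    "g q = (\<Sum>c<n. A (i mod m, c, (s + r - q) mod s) * B (c, j mod p, q))" for q
  have "bcirc m p s (t_product m n p s A B) $$ (i, j) = (\<Sum>q<s. g q)"
    using ij b \<open>r < s\<close> by (simp add: bcirc_index t_product_index g_def flip: r_def)
  also have "\<dots> = (\<Sum>q<s. g ((s + q - j div p) mod s))"
    using b by (intro sum_cyclic_shift[symmetric])
  \<comment> \<open>After the shift the slice index of \<open>B\<close> is already the one in the
    matrix product; that of \<open>A\<close> becomes so because the two subtractions of
    \<open>j div p\<close> cancel.\<close>
  also have "\<dots> = (bcirc m n s A * bcirc n p s B) $$ (i, j)"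
    using ij b by (simp add: bcirc_mult_index g_def r_def cyclic_difference_shift)
  finally show "bcirc m p s (t_product m n p s A B) $$ (i, j) =
      (bcirc m n s A * bcirc n p s B) $$ (i, j)" .
qed (auto simp: bcirc_def)

lemma module_cubic_simps:
  "carrier (module_cubic m n s) = carrier_cubic m n s"
  "zero (module_cubic m n s) = (\<lambda>t\<in>cubic_index m n s. 0)"
  "add (module_cubic m n s) A B = (\<lambda>t\<in>cubic_index m n s. A t + B t)"
  "module.smult (module_cubic m n s) c A = (\<lambda>t\<in>cubic_index m n s. c * A t)"
  by (simp_all add: module_cubic_def)

lemma carrier_cubic_restrict: "(\<lambda>t\<in>cubic_index m n s. f t) \<in> carrier_cubic m n s"
  by (simp add: carrier_cubic_def)

lemma carrier_cubic_eqI: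
  assumes "A \<in> carrier_cubic m n s" and "B \<in> carrier_cubic m n s"
    and "\<And>t. t \<in> cubic_index m n s \<Longrightarrow> A t = B t"
  shows "A = B"
  using assms unfolding carrier_cubic_def by (rule PiE_ext)

text \<open>Needed because \<open>linear_map\<close> includes that its domain is a vector space. The
  axioms hold entrywise, by those of the reals.\<close>

lemma module_cubic_vectorspace:
  "vectorspace (class_ring :: real ring) (module_cubic m n s)"
proof (rule vectorspace.intro)
  show "field (class_ring :: real ring)" by (rule class_field)
  have "abelian_group (module_cubic m n s)"
  proof (rule abelian_groupI)
    fix A assume "A \<in> carrier (module_cubic m n s)"
    show "\<exists>B\<in>carrier (module_cubic m n s).
        B \<oplus>\<^bsub>module_cubic m n s\<^esub> A = \<zero>\<^bsub>module_cubic m n s\<^esub>"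
      \<comment> \<open>The entrywise negative is restricted so that it is extensional and lies in
        the carrier.\<close>
      by (rule bexI[of _ "\<lambda>t\<in>cubic_index m n s. - A t"])
        (auto simp: module_cubic_simps carrier_cubic_restrict)
  qed (auto simp: module_cubic_simps carrier_cubic_restrict add_ac intro!: carrier_cubic_eqI[of _ m n s])
  with class_cring.is_cring show "Module.module (class_ring :: real ring) (module_cubic m n s)"
    by (rule Module.moduleI)
      (auto simp: module_cubic_simps carrier_cubic_restrict algebra_simps
        intro!: carrier_cubic_eqI[of _ m n s])
qed

lemma bcirc_linear_map:
  assumes "0 < m" and "0 < n" and "0 < s"
  shows "linear_map (class_ring :: real ring) (module_cubic m n s)
    (module_mat TYPE(real) (s * m) (s * n)) (bcirc m n s)"
proof -
  \<comment> \<open>The restricted operations give \<open>undefined\<close> off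
    \<open>cubic_index\<close>; positive dimensions ensure that \<open>bcirc\<close> reads only
    inside it.\<close>
  have idx: "(i mod m, j mod n, k mod s) \<in> cubic_index m n s" for i j k
    using assms by (simp add: cubic_index_def)
  have add: "bcirc m n s (\<lambda>t\<in>cubic_index m n s. A t + B t) = bcirc m n s A + bcirc m n s B" for A B
    by (intro eq_matI) (auto simp: bcirc_index dim_bcirc idx)
  have smult: "bcirc m n s (\<lambda>t\<in>cubic_index m n s. c * A t) = c \<cdot>\<^sub>m bcirc m n s A" for c A
    by (intro eq_matI) (auto simp: bcirc_index dim_bcirc idx)
  have "bcirc m n s \<in> LinearCombinations.module_hom (class_ring :: real ring)
      (module_cubic m n s) (module_mat TYPE(real) (s * m) (s * n))"
    by (auto simp: LinearCombinations.module_hom_def module_cubic_simps module_mat_simps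
        bcirc_carrier_mat add smult)
  then show ?thesis
    using module_cubic_vectorspace matrix_vs[where 'a = real]
    by (simp add: linear_map_def mod_hom_def mod_hom_axioms_def vectorspace_def)
qed

theorem proposition8:
  fixes m n p s :: nat
  assumes "0 < m" and "0 < n" and "0 < p" and "0 < s"
  shows "linear_map (class_ring :: real ring) (module_cubic m n s)
           (module_mat TYPE(real) (s * m) (s * n)) (bcirc m n s) \<and>
         (\<forall>A \<in> carrier_cubic m n s. \<forall>B \<in> carrier_cubic n p s.
           bcirc m p s (t_product m n p s A B) = bcirc m n s A * bcirc n p s B)"
  using bcirc_linear_map[OF assms(1,2,4)] by (simp add: bcirc_t_product)

end
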